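(* Let $\Omega\subset\mathbb{R}$ be a bounded set, let $\theta\ge 0$ and $1\le p\le\infty$ (within the range $1<p,q<\infty$ for which the spaces below are defined), and let $\Psi=(\psi_i)_{i\in I}$ be a bounded uniform partition of unity on $\Omega$, with corresponding points $(y_i)_{i\in I}\subset\Omega$ and compact set $U\subset\Omega$. Then $$\|f\|_{W(L^{p),\theta},L^{q),\theta})}\asymp\Big\|\sum_{i\in I}\|f\psi_i\|_{p),\theta}\,\chi_{U+y_i}\Big\|_{q),\theta}=\Big\|\big\{\|f\psi_i\|_{p),\theta}\big\}_{i\in I}\Big\|_{\ell^{q),\theta}}.$$
   Context: $A(f)\asymp B(f)$ means equivalence of norms: there are constants $0<c\le C<\infty$ independent of $f$ with $cA(f)\le B(f)\le CA(f)$. $\mu$ denotes Lebesgue measure and $\chi_E$ the characteristic function of $E$. Generalized grand Lebesgue space: for $1<p<\infty$, $\theta\ge 0$, $L^{p),\theta}=L^{p),\theta}(\Omega)$ is the space of (classes of) measurable functions $f$ on $\Omega$ with $$\|f\|_{p),\theta}=\sup_{0<\varepsilon\le p-1}\varepsilon^{\frac{\theta}{p-\varepsilon}}\Big(\int_\Omega|f|^{p-\varepsilon}d\mu\Big)^{\frac1{p-\varepsilon}}<\infty;$$ for $\theta=0$ it reduces to $L^p(\Omega)$. $(L^{p),\theta})_{loc}$ is the space of (classes of) measurable $f:\Omega\to\mathbb{C}$ with $f\chi_K\in L^{p),\theta}$ for every compact $K\subset\Omega$. Grand Lebesgue sequence space: $\ell^{q),\theta}=\ell^{q),\theta}(I)$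 is the space of scalar families $u=(u_k)_{k\in I}$ with $$\|u\|_{\ell^{q),\theta}}=\sup_{0<\eta\le q-1}\Big(\eta^{\theta}\sum_{k\in I}|u_k|^{q-\eta}\Big)^{\frac1{q-\eta}}<\infty.$$ Grand Wiener amalgam space: let $1<p,q<\infty$ and fix a compact set $Q\subset\Omega$ with nonempty interior. $W(L^{p),\theta},L^{q),\theta})$ consists of all $f\in(L^{p),\theta})_{loc}$ whose control function $F_f^{p),\theta}(x)=\|f\chi_{Q+x}\|_{p),\theta}$ lies in $L^{q),\theta}$, with norm $$\|f\|_{W(L^{p),\theta},L^{q),\theta})}=\big\|F_f^{p),\theta}\big\|_{q),\theta}=\big\|\,\|f\chi_{Q+x}\|_{p),\theta}\big\|_{q),\theta}.$$ The definition depends on the choice of $Q$. Bounded uniform partition of unity: a family of non-negative functions $\Psi=(\psi_i)_{i\in I}$ on $\Omega$ corresponding to points $(y_i)_{i\in I}$ in $\Omega$ such that (a) $\sum_{i}\psi_i\equiv1$; (b) $\sup_{i\in I}\|\psi_i\|_{L^\infty}<M$ for some $M>0$; (c) there is a compact set $U\subset\Omega$ with nonempty interior such that $\operatorname{supp}(\psi_i)\subset U+y_i$ for all $i\in I$; (d) for each compact $K\subset\Omega$, $$\sup_{x\in\Omega}\#\{i\in I:x\in K+y_i\}=\sup_{i\in I}\#\{j\in I:(K+y_i)\cap(K+y_j)\neq\emptyset\}<\infty.$$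
   Formalization: The final "=" is read as equivalence of norms (equality is false); with outer norm over Ω the first equivalence assumes a.e. z in Ω lies in Q+x for a set of x in Ω of measure ≥ c > 0 (it fails e.g. for Ω=[0,1]); with outer norm over the real line it is unconditional. Ω is measurable. *)

theory Defs
  imports "HOL-Analysis.Analysis" "HOL-Probability.Essential_Supremum"
begin

(* Only used with exponents a > 0, so that the infinite value is sent to itself. *)
definition ennpowr :: "ennreal \<Rightarrow> real \<Rightarrow> ennreal" where
  "ennpowr t a = (if t = \<infinity> then \<infinity> else ennreal (enn2real t powr a))"

(* The grand Lebesgue functional on a measurable set D, for functions with values in [0, \<infinity>].
   All norms below are extended-valued: the value \<infinity> means that the function (family) is not
   in the space. *)
definition grand_functional :: "real set \<Rightarrow> real \<Rightarrow> real \<Rightarrow> (real \<Rightarrow> ennreal) \<Rightarrow> ennreal" where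
  "grand_functional D p \<theta> g =
     (SUP \<epsilon>\<in>{0<..p - 1}. ennreal (\<epsilon> powr (\<theta> / (p - \<epsilon>))) *
        ennpowr (\<integral>\<^sup>+ x. ennpowr (g x) (p - \<epsilon>) \<partial>lebesgue_on D) (1 / (p - \<epsilon>)))"

definition grand_norm :: "real set \<Rightarrow> real \<Rightarrow> real \<Rightarrow> (real \<Rightarrow> complex) \<Rightarrow> ennreal" where
  "grand_norm \<Omega> p \<theta> f = grand_functional \<Omega> p \<theta> (\<lambda>x. ennreal (norm (f x)))"

definition grand_space :: "real set \<Rightarrow> real \<Rightarrow> real \<Rightarrow> (real \<Rightarrow> complex) set" where
  "grand_space \<Omega> p \<theta> =
     {f. f \<in> borel_measurable (lebesgue_on \<Omega>) \<and> grand_norm \<Omega> p \<theta> f < \<infinity>}"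

definition grand_space_loc :: "real set \<Rightarrow> real \<Rightarrow> real \<Rightarrow> (real \<Rightarrow> complex) set" where
  "grand_space_loc \<Omega> p \<theta> =
     {f. f \<in> borel_measurable (lebesgue_on \<Omega>) \<and>
         (\<forall>K. compact K \<and> K \<subseteq> \<Omega> \<longrightarrow> (\<lambda>x. indicator K x * f x) \<in> grand_space \<Omega> p \<theta>)}"

definition grand_seq_norm :: "'i set \<Rightarrow> real \<Rightarrow> real \<Rightarrow> ('i \<Rightarrow> ennreal) \<Rightarrow> ennreal" where
  "grand_seq_norm I q \<theta> u =
     (SUP \<eta>\<in>{0<..q - 1}.
        ennpowr (ennreal (\<eta> powr \<theta>) * (\<Sum>\<^sub>\<infinity>k\<in>I. ennpowr (u k) (q - \<eta>))) (1 / (q - \<eta>)))"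

definition translate :: "real set \<Rightarrow> real \<Rightarrow> real set" where
  "translate E x = (\<lambda>t. t + x) ` E"

definition control :: "real set \<Rightarrow> real set \<Rightarrow> real \<Rightarrow> real \<Rightarrow> (real \<Rightarrow> complex) \<Rightarrow> real \<Rightarrow> ennreal" where
  "control \<Omega> Q p \<theta> f x = grand_norm \<Omega> p \<theta> (\<lambda>t. indicator (translate Q x) t * f t)"

(* The translates Q + x and U + y i need not stay inside \<Omega>, so the control function and the step
   functions built from U + y i are functions on the real line. The set D is the domain over which
   their outer (global) norm is taken: D = \<Omega>, or D = UNIV. The inner (local) norm is always over
   \<Omega>. *)
definition amalgam_norm ::
  "real set \<Rightarrow> real set \<Rightarrow> real set \<Rightarrow> real \<Rightarrow> real \<Rightarrow> real \<Rightarrow> (real \<Rightarrow> complex) \<Rightarrow> ennreal" where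
  "amalgam_norm \<Omega> D Q p q \<theta> f = grand_functional D q \<theta> (control \<Omega> Q p \<theta> f)"

(* The measure condition on Q and \<Omega> that is automatic, with c the measure of Q, if x ranges over
   the whole line: almost every point of \<Omega> lies in Q + x for a set of x in \<Omega> of measure at
   least c. It fails, for every compact Q, for \<Omega> = [0, 1]: functions concentrated near 0 are
   then hardly seen by their control function on \<Omega>. *)
definition window_nondegenerate :: "real set \<Rightarrow> real set \<Rightarrow> bool" where
  "window_nondegenerate \<Omega> Q \<longleftrightarrow>
     (\<exists>c>0. AE z in lebesgue_on \<Omega>. ennreal c \<le> emeasure lebesgue {x \<in> \<Omega>. z \<in> translate Q x})"

definition piece_norm ::
  "real set \<Rightarrow> ('i \<Rightarrow> real \<Rightarrow> real) \<Rightarrow> real \<Rightarrow> real \<Rightarrow> (real \<Rightarrow> complex) \<Rightarrow> 'i \<Rightarrow> ennreal" where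
  "piece_norm \<Omega> \<psi> p \<theta> f i = grand_norm \<Omega> p \<theta> (\<lambda>t. f t * of_real (\<psi> i t))"

definition step_norm ::
  "real set \<Rightarrow> real set \<Rightarrow> 'i set \<Rightarrow> ('i \<Rightarrow> real \<Rightarrow> real) \<Rightarrow> ('i \<Rightarrow> real) \<Rightarrow> real set \<Rightarrow>
   real \<Rightarrow> real \<Rightarrow> real \<Rightarrow> (real \<Rightarrow> complex) \<Rightarrow> ennreal" where
  "step_norm \<Omega> D I \<psi> y U p q \<theta> f =
     grand_functional D q \<theta>
       (\<lambda>x. \<Sum>\<^sub>\<infinity>i\<in>I. piece_norm \<Omega> \<psi> p \<theta> f i * indicator (translate U (y i)) x)"

(* Cardinalities are taken as counting measures, so that an infinite set counts as \<infinity>. *)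
definition bupu ::
  "real set \<Rightarrow> 'i set \<Rightarrow> ('i \<Rightarrow> real \<Rightarrow> real) \<Rightarrow> ('i \<Rightarrow> real) \<Rightarrow> real set \<Rightarrow> bool" where
  "bupu \<Omega> I \<psi> y U \<longleftrightarrow>
     (\<forall>i\<in>I. y i \<in> \<Omega> \<and> \<psi> i \<in> borel_measurable (lebesgue_on \<Omega>) \<and> (\<forall>x\<in>\<Omega>. 0 \<le> \<psi> i x)) \<and>
     (\<forall>x\<in>\<Omega>. ((\<lambda>i. \<psi> i x) has_sum 1) I) \<and>
     (\<exists>M>0. (SUP i\<in>I. esssup (lebesgue_on \<Omega>) (\<lambda>x. ereal \<bar>\<psi> i x\<bar>)) < ereal M) \<and>
     compact U \<and> U \<subseteq> \<Omega> \<and> interior U \<noteq> {} \<and>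
     (\<forall>i\<in>I. closure {x \<in> \<Omega>. \<psi> i x \<noteq> 0} \<subseteq> translate U (y i)) \<and>
     (\<forall>K. compact K \<and> K \<subseteq> \<Omega> \<longrightarrow>
        (SUP x\<in>\<Omega>. emeasure (count_space I) {i \<in> I. x \<in> translate K (y i)}) =
        (SUP i\<in>I. emeasure (count_space I)
           {j \<in> I. translate K (y i) \<inter> translate K (y j) \<noteq> {}}) \<and>
        (SUP i\<in>I. emeasure (count_space I)
           {j \<in> I. translate K (y i) \<inter> translate K (y j) \<noteq> {}}) < \<infinity>)"

definition norm_equiv ::
  "'f set \<Rightarrow> ('f \<Rightarrow> ennreal) \<Rightarrow> ('f \<Rightarrow> ennreal) \<Rightarrow> bool" where
  "norm_equiv S A B \<longleftrightarrow>
     (\<exists>c C::real. 0 < c \<and> c \<le> C \<and> (\<forall>f\<in>S. ennreal c * A f \<le> B f \<and> B f \<le> ennreal C * A f))"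

end

theory Submission
  imports Defs
begin

text \<open>
  As \<open>\<Omega>\<close> is bounded, condition (d) applied to the window \<open>U\<close> leaves only finitely many indices. Hence
  all norms are compared with the sum of the norms of the pieces \<open>f \<psi>\<^sub>i\<close>, equivalently with the
  grand norm of \<open>f\<close> itself, and the comparison constants may depend on the number of indices. The one
  estimate that is not a pointwise bound is that of \<open>\<parallel>f\<parallel>\<close> by the amalgam norm: keep only the
  \<open>L\<^sup>1\<close> norm of the control function (the parameter \<open>\<epsilon> = q - 1\<close>); writing \<open>G(x)\<close> for the integral of
  \<open>\<bar>f\<bar>\<^sup>r\<close> over \<open>Q + x\<close> and \<open>T\<close> for its integral over \<open>\<Omega>\<close>, the inequality \<open>G \<le> T\<close> bounds
  \<open>G powr (1/r)\<close> from below by \<open>T powr (1/r - 1) * G\<close>, whose integral is computed by Fubini.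
\<close>

section \<open>Powers of extended nonnegative reals\<close>

lemma ennpowr_0 [simp]: "ennpowr 0 a = 0"
  by (simp add: ennpowr_def)

lemma ennpowr_top [simp]: "ennpowr top a = top"
  by (simp add: ennpowr_def)

lemma ennpowr_ennreal: "0 \<le> x \<Longrightarrow> ennpowr (ennreal x) a = ennreal (x powr a)"
  by (simp add: ennpowr_def)

lemma ennpowr_one_right [simp]: "ennpowr t 1 = t"
  by (cases t) (simp_all add: ennpowr_ennreal)

lemma ennpowr_mono: "s \<le> t \<Longrightarrow> 0 \<le> a \<Longrightarrow> ennpowr s a \<le> ennpowr t a"
  by (cases s; cases t) (auto simp: ennpowr_ennreal top_unique intro!: ennreal_leI powr_mono2)

text \<open>The exponent may have any sign: \<open>0 powr a = 0\<close> for every \<open>a\<close>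
  and \<open>0 * top = 0\<close>, so zero and infinite factors obey the same law.\<close>

lemma ennpowr_mult: "ennpowr (s * t) a = ennpowr s a * ennpowr t a"
proof (cases s; cases t)
  fix x y :: real
  assume "0 \<le> x" "s = ennreal x" "0 \<le> y" "t = ennreal y"
  then show ?thesis
    by (simp add: ennpowr_ennreal powr_mult flip: ennreal_mult)
qed (auto simp: ennpowr_ennreal ennreal_mult_top ennreal_top_mult top_ennreal_def[symmetric])

lemma ennpowr_ennpowr: "ennpowr (ennpowr t a) b = ennpowr t (a * b)"
  by (cases t) (simp_all add: ennpowr_ennreal powr_powr)

lemma ennpowr_indicator: "ennpowr (indicator E x * t) a = indicator E x * ennpowr t a"
  by (simp add: indicator_def)

lemma borel_measurable_ennpowr [measurable]:
  assumes [measurable]: "f \<in> borel_measurable M"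
  shows "(\<lambda>x. ennpowr (f x) a) \<in> borel_measurable M"
  unfolding ennpowr_def by measurable

section \<open>Comparison of norms up to a constant\<close>

definition dominated :: "'f set \<Rightarrow> ('f \<Rightarrow> ennreal) \<Rightarrow> ('f \<Rightarrow> ennreal) \<Rightarrow> bool" where
  "dominated S A B \<longleftrightarrow> (\<exists>C>0. \<forall>f\<in>S. A f \<le> ennreal C * B f)"

lemma dominatedI: "0 < C \<Longrightarrow> (\<And>f. f \<in> S \<Longrightarrow> A f \<le> ennreal C * B f) \<Longrightarrow> dominated S A B"
  unfolding dominated_def by blast

lemma dominated_trans [trans]:
  assumes "dominated S A B" "dominated S B G"
  shows "dominated S A G"
proof -
  obtain C C' where C: "C > 0" "\<And>f. f \<in> S \<Longrightarrow> A f \<le> ennreal C * B f"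
    and C': "C' > 0" "\<And>f. f \<in> S \<Longrightarrow> B f \<le> ennreal C' * G f"
    using assms unfolding dominated_def by blast
  show ?thesis
  proof (rule dominatedI[of "C * C'"])
    fix f assume f: "f \<in> S"
    have "A f \<le> ennreal C * (ennreal C' * G f)"
      using C(2)[OF f] C'(2)[OF f] by (meson order_trans mult_left_mono zero_le)
    then show "A f \<le> ennreal (C * C') * G f"
      using C(1) C'(1) by (simp add: ennreal_mult mult.assoc)
  qed (use C(1) C'(1) in simp)
qed

lemma norm_equiv_if_dominated:
  assumes "dominated S A B" "dominated S B A"
  shows "norm_equiv S A B"
proof -
  obtain C C' where C: "C > 0" "\<And>f. f \<in> S \<Longrightarrow> A f \<le> ennreal C * B f"
    and C': "C' > 0" "\<And>f. f \<in> S \<Longrightarrow> B f \<le> ennreal C' * A f"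
    using assms unfolding dominated_def by blast
  have "ennreal (1 / C) * A f \<le> B f" if "f \<in> S" for f
  proof -
    have "ennreal (1 / C) * A f \<le> ennreal (1 / C) * (ennreal C * B f)"
      using C(2)[OF that] by (intro mult_left_mono) auto
    also have "\<dots> = B f"
      using C(1) by (simp flip: mult.assoc ennreal_mult)
    finally show ?thesis .
  qed
  \<comment> \<open>The maximum with \<open>1 / C\<close> secures the order of the two constants
    that \<open>norm_equiv\<close> demands.\<close>
  moreover have "B f \<le> ennreal (max C' (1 / C)) * A f" if "f \<in> S" for f
    by (rule order_trans[OF C'(2)[OF that]]) (intro mult_right_mono ennreal_leI, auto)
  ultimately show ?thesis
    unfolding norm_equiv_def using C(1)
    by (intro exI[of _ "1 / C"] exI[of _ "max C' (1 / C)"]) auto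
qed

section \<open>Estimates of the grand functional\<close>

text \<open>The value at the extreme parameter \<open>\<epsilon> = p - 1\<close>.\<close>
lemma grand_functional_ge_integral:
  assumes "1 < p"
  shows "ennreal ((p - 1) powr \<theta>) * (\<integral>\<^sup>+x. g x \<partial>lebesgue_on D) \<le> grand_functional D p \<theta> g"
  unfolding grand_functional_def
  by (rule SUP_upper2[of "p - 1"]) (use assms in auto)

text \<open>The almost everywhere form serves the pieces that are known to vanish only off a null
  set.\<close>

lemma grand_functional_mono_AE:
  assumes "AE x in lebesgue_on D. g x \<le> h x"
  shows "grand_functional D p \<theta> g \<le> grand_functional D p \<theta> h"
  unfolding grand_functional_def
proof (rule SUP_subset_mono[OF order_refl])
  fix \<epsilon> assume \<epsilon>: "\<epsilon> \<in> {0<..p - 1}"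
  have "AE x in lebesgue_on D. ennpowr (g x) (p - \<epsilon>) \<le> ennpowr (h x) (p - \<epsilon>)"
    using assms by eventually_elim (use \<epsilon> in \<open>auto intro: ennpowr_mono\<close>)
  then show "ennreal (\<epsilon> powr (\<theta> / (p - \<epsilon>))) * ennpowr (\<integral>\<^sup>+ x. ennpowr (g x) (p - \<epsilon>) \<partial>lebesgue_on D) (1 / (p - \<epsilon>))
     \<le> ennreal (\<epsilon> powr (\<theta> / (p - \<epsilon>))) * ennpowr (\<integral>\<^sup>+ x. ennpowr (h x) (p - \<epsilon>) \<partial>lebesgue_on D) (1 / (p - \<epsilon>))"
    using \<epsilon> by (intro mult_left_mono ennpowr_mono nn_integral_mono_AE) auto
qed

text \<open>Raising the base to at least 1 makes the power increasing in its exponent, and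
  \<open>p - \<epsilon> \<ge> 1\<close> keeps that exponent below \<open>\<theta>\<close>. The bound
  is therefore uniform in \<open>\<epsilon>\<close>.\<close>

lemma weight_powr_le:
  fixes p \<epsilon> \<theta> :: real
  assumes "\<epsilon> \<in> {0<..p - 1}" "0 \<le> \<theta>"
  shows "\<epsilon> powr (\<theta> / (p - \<epsilon>)) \<le> max 1 (p - 1) powr \<theta>"
proof -
  have "\<epsilon> powr (\<theta> / (p - \<epsilon>)) \<le> max 1 (p - 1) powr (\<theta> / (p - \<epsilon>))"
    using assms by (intro powr_mono2) auto
  also have "\<theta> / (p - \<epsilon>) \<le> \<theta> / 1"
    using assms by (intro divide_left_mono) auto
  then have "max 1 (p - 1) powr (\<theta> / (p - \<epsilon>)) \<le> max 1 (p - 1) powr \<theta>"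
    by (intro powr_mono) auto
  finally show ?thesis .
qed

text \<open>The source of all upper bounds for outer norms. The term at exponent \<open>r\<close> is
  at most its weight times \<open>a * M powr (1 / r)\<close>; since \<open>r \<ge> 1\<close> and
  \<open>M \<ge> 1\<close>, the power is at most \<open>M\<close>, which removes the dependence on
  \<open>\<epsilon>\<close>. The height \<open>a\<close> may be infinite.\<close>

lemma grand_functional_le_const:
  assumes "1 < q" "0 \<le> \<theta>" "D \<in> sets lebesgue" "E \<in> sets lebesgue" "emeasure lebesgue E \<le> ennreal M" "1 \<le> M"
    and g: "\<And>x. x \<in> D \<Longrightarrow> g x \<le> a * indicator E x"
  shows "grand_functional D q \<theta> g \<le> ennreal (max 1 (q - 1) powr \<theta> * M) * a"
  unfolding grand_functional_def
proof (rule SUP_least)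
  fix \<epsilon> assume \<epsilon>: "\<epsilon> \<in> {0<..q - 1}"
  define r where "r = q - \<epsilon>"
  have r: "1 \<le> r" using \<epsilon> by (auto simp: r_def)
  have "(\<integral>\<^sup>+ x. ennpowr (g x) r \<partial>lebesgue_on D)
      \<le> (\<integral>\<^sup>+ x. ennpowr (g x) r * indicator D x \<partial>lebesgue)"
    using assms(3) by (simp add: nn_integral_restrict_space)
  also have "\<dots> \<le> (\<integral>\<^sup>+ x. ennpowr a r * indicator E x \<partial>lebesgue)"
  proof (rule nn_integral_mono)
    fix x
    show "ennpowr (g x) r * indicator D x \<le> ennpowr a r * indicator E x"
      using ennpowr_mono[OF g[of x], of r] r ennpowr_indicator[of E x a r]
      by (auto simp: mult.commute indicator_def)
  qed
  also have "\<dots> \<le> ennpowr a r * ennreal M"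
    using assms(4,5) by (simp add: nn_integral_cmult_indicator mult_left_mono)
  finally have "ennpowr (\<integral>\<^sup>+ x. ennpowr (g x) r \<partial>lebesgue_on D) (1 / r) \<le> ennpowr (ennpowr a r * ennreal M) (1 / r)"
    by (rule ennpowr_mono) (use r in auto)
  also have "\<dots> = a * ennreal (M powr (1 / r))"
    using r \<open>1 \<le> M\<close> by (simp add: ennpowr_mult ennpowr_ennpowr ennpowr_ennreal)
  also have "\<dots> \<le> a * ennreal M"
    using r \<open>1 \<le> M\<close> powr_mono[of "1 / r" 1 M] by (intro mult_left_mono ennreal_leI) auto
  finally have *: "ennpowr (\<integral>\<^sup>+ x. ennpowr (g x) r \<partial>lebesgue_on D) (1 / r) \<le> a * ennreal M" .
  have "ennreal (\<epsilon> powr (\<theta> / r)) * ennpowr (\<integral>\<^sup>+ x. ennpowr (g x) r \<partial>lebesgue_on D) (1 / r)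
     \<le> ennreal (max 1 (q - 1) powr \<theta>) * (a * ennreal M)"
    using weight_powr_le[OF \<epsilon> assms(2)] by (intro mult_mono * ennreal_leI) (auto simp: r_def)
  also have "\<dots> = ennreal (max 1 (q - 1) powr \<theta> * M) * a"
    using \<open>1 \<le> M\<close> by (simp add: ennreal_mult mult_ac)
  finally show "ennreal (\<epsilon> powr (\<theta> / (q - \<epsilon>))) * ennpowr (\<integral>\<^sup>+ x. ennpowr (g x) (q - \<epsilon>) \<partial>lebesgue_on D) (1 / (q - \<epsilon>))
     \<le> ennreal (max 1 (q - 1) powr \<theta> * M) * a"
    by (simp add: r_def)
qed

lemma sum_le_card_mult_ennreal:
  fixes a :: "'i \<Rightarrow> ennreal"
  assumes "finite I" "I \<noteq> {}"
  shows "\<exists>i\<in>I. (\<Sum>j\<in>I. a j) \<le> of_nat (card I) * a i"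
proof -
  have "Max (a ` I) \<in> a ` I"
    using assms by (intro Max_in) auto
  then obtain i where i: "i \<in> I" "Max (a ` I) = a i"
    by blast
  then have "a j \<le> a i" if "j \<in> I" for j
    using assms that by (simp flip: i(2))
  with i(1) show ?thesis
    using sum_bounded_above[of I a "a i"] by blast
qed

text \<open>A crude substitute for convexity: a finite sum is at most its length times its largest
  term. It covers exponents on both sides of 1, as it is used with \<open>r\<close> and with
  \<open>1 / r\<close>.\<close>

lemma ennpowr_sum_le:
  fixes a :: "'i \<Rightarrow> ennreal"
  assumes "finite I" "0 < r"
  shows "ennpowr (\<Sum>i\<in>I. a i) r \<le> ennpowr (of_nat (card I)) r * (\<Sum>i\<in>I. ennpowr (a i) r)"
proof (cases "I = {}")
  case False
  then obtain i where i: "i \<in> I" "(\<Sum>j\<in>I. a j) \<le> of_nat (card I) * a i"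
    using sum_le_card_mult_ennreal[OF assms(1)] by blast
  have "ennpowr (\<Sum>i\<in>I. a i) r \<le> ennpowr (of_nat (card I)) r * ennpowr (a i) r"
    using ennpowr_mono[OF i(2), of r] assms by (simp add: ennpowr_mult)
  also have "\<dots> \<le> ennpowr (of_nat (card I)) r * (\<Sum>i\<in>I. ennpowr (a i) r)"
    using i assms by (intro mult_left_mono member_le_sum) auto
  finally show ?thesis .
qed auto

lemma ennpowr_of_nat_le:
  assumes "0 \<le> a" "a \<le> 1"
  shows "ennpowr (of_nat n) a \<le> of_nat n"
proof (cases "n = 0")
  case False
  then have "real n powr a \<le> real n powr 1"
    using assms by (intro powr_mono) auto
  then show ?thesis
    using False by (simp add: ennpowr_ennreal flip: ennreal_of_nat_eq_real_of_nat)
       (metis ennpowr_ennreal ennreal_leI ennreal_of_nat_eq_real_of_nat of_nat_0_le_iff powr_one)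
qed auto

text \<open>A triangle inequality with a constant. \<open>ennpowr_sum_le\<close> is applied under
  the integral with exponent \<open>r\<close>, where the later root turns its factor into
  \<open>n\<close>, and then outside with exponent \<open>1 / r\<close>, where the factor is at most
  \<open>n\<close>. This gives the square of the cardinality.\<close>

lemma grand_functional_sum_le:
  assumes "finite I" and [measurable]: "\<And>i. i \<in> I \<Longrightarrow> g i \<in> borel_measurable (lebesgue_on D)"
  shows "grand_functional D p \<theta> (\<lambda>x. \<Sum>i\<in>I. g i x)
     \<le> of_nat (card I * card I) * (\<Sum>i\<in>I. grand_functional D p \<theta> (g i))"
  unfolding grand_functional_def[of D p \<theta> "\<lambda>x. \<Sum>i\<in>I. g i x"]
proof (rule SUP_least)
  fix \<epsilon> assume \<epsilon>: "\<epsilon> \<in> {0<..p - 1}"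
  define r where "r = p - \<epsilon>"
  define n :: ennreal where "n = of_nat (card I)"
  define T where "T i = (\<integral>\<^sup>+ x. ennpowr (g i x) r \<partial>lebesgue_on D)" for i
  have r: "1 \<le> r" using \<epsilon> by (auto simp: r_def)
  have "(\<integral>\<^sup>+ x. ennpowr (\<Sum>i\<in>I. g i x) r \<partial>lebesgue_on D)
     \<le> (\<integral>\<^sup>+ x. ennpowr n r * (\<Sum>i\<in>I. ennpowr (g i x) r) \<partial>lebesgue_on D)"
    unfolding n_def using r assms(1) by (intro nn_integral_mono ennpowr_sum_le) auto
  also have "\<dots> = ennpowr n r * (\<Sum>i\<in>I. T i)"
    by (simp add: nn_integral_cmult nn_integral_sum T_def)
  finally have "ennpowr (\<integral>\<^sup>+ x. ennpowr (\<Sum>i\<in>I. g i x) r \<partial>lebesgue_on D) (1 / r)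
     \<le> ennpowr (ennpowr n r * (\<Sum>i\<in>I. T i)) (1 / r)"
    by (rule ennpowr_mono) (use r in auto)
  also have "\<dots> = n * ennpowr (\<Sum>i\<in>I. T i) (1 / r)"
    using r by (simp add: ennpowr_mult ennpowr_ennpowr)
  also have "\<dots> \<le> n * (ennpowr n (1 / r) * (\<Sum>i\<in>I. ennpowr (T i) (1 / r)))"
    unfolding n_def using r assms(1) by (intro mult_left_mono ennpowr_sum_le) auto
  also have "\<dots> \<le> n * (n * (\<Sum>i\<in>I. ennpowr (T i) (1 / r)))"
    unfolding n_def using r by (intro mult_left_mono mult_right_mono ennpowr_of_nat_le) auto
  finally have "ennreal (\<epsilon> powr (\<theta> / r)) * ennpowr (\<integral>\<^sup>+ x. ennpowr (\<Sum>i\<in>I. g i x) r \<partial>lebesgue_on D) (1 / r)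
     \<le> ennreal (\<epsilon> powr (\<theta> / r)) * (n * (n * (\<Sum>i\<in>I. ennpowr (T i) (1 / r))))"
    by (rule mult_left_mono) auto
  also have "\<dots> = of_nat (card I * card I) * (\<Sum>i\<in>I. ennreal (\<epsilon> powr (\<theta> / r)) * ennpowr (T i) (1 / r))"
    by (simp add: n_def sum_distrib_left mult_ac)
  also have "\<dots> \<le> of_nat (card I * card I) * (\<Sum>i\<in>I. grand_functional D p \<theta> (g i))"
    unfolding grand_functional_def r_def T_def using \<epsilon>
    by (intro mult_left_mono sum_mono SUP_upper) auto
  finally show "ennreal (\<epsilon> powr (\<theta> / (p - \<epsilon>))) *
        ennpowr (\<integral>\<^sup>+ x. ennpowr (\<Sum>i\<in>I. g i x) (p - \<epsilon>) \<partial>lebesgue_on D) (1 / (p - \<epsilon>))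
     \<le> of_nat (card I * card I) * (\<Sum>i\<in>I. grand_functional D p \<theta> (g i))"
    by (simp add: r_def)
qed

section \<open>Integrals over moving windows\<close>

lemma mem_translate_iff: "t \<in> translate E x \<longleftrightarrow> t - x \<in> E"
  by (force simp: translate_def)

text \<open>The positions \<open>x\<close> whose window contains \<open>z\<close> form the reflected
  set \<open>z - Q\<close>, which is closed.\<close>

lemma borel_translate_set:
  assumes "closed Q"
  shows "{x. z \<in> translate Q x} \<in> sets borel"
proof -
  have "closed ((\<lambda>x. z - x) -` Q)"
    using assms by (intro closed_vimage continuous_intros)
  then show ?thesis
    by (simp add: mem_translate_iff vimage_def)
qed

text \<open>Fubini for Lebesgue measurable data needs Borel representatives, as the product of two
  completed measures is not complete.\<close>
lemma window_fubini:
  fixes h :: "real \<Rightarrow> ennreal"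
  assumes \<Omega>: "\<Omega> \<in> sets lebesgue" and D: "D \<in> sets lebesgue" and Q: "closed Q"
    and h: "h \<in> borel_measurable (lebesgue_on \<Omega>)"
    and c: "AE z in lebesgue_on \<Omega>. c \<le> emeasure lebesgue {x \<in> D. z \<in> translate Q x}"
  shows "c * (\<integral>\<^sup>+t. h t \<partial>lebesgue_on \<Omega>)
     \<le> (\<integral>\<^sup>+x. \<integral>\<^sup>+t. indicator (translate Q x) t * h t \<partial>lebesgue_on \<Omega> \<partial>lebesgue_on D)"
proof -
  have "(\<lambda>t. h t * indicator \<Omega> t) \<in> borel_measurable lebesgue"
    using h \<Omega> by (simp add: borel_measurable_restrict_space_iff_ennreal)
  then obtain H where [measurable]: "H \<in> borel_measurable lborel"
    and H: "AE t in lborel. h t * indicator \<Omega> t = H t"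
    using completion_ex_borel_measurable by blast
  \<comment> \<open>The Borel version \<open>d\<close> of the indicator carries the restriction of
    \<open>x\<close> to \<open>D\<close> through Fubini as a factor of the integrand.\<close>
  have "(indicator D :: real \<Rightarrow> ennreal) \<in> borel_measurable lebesgue"
    using D by simp
  then obtain d :: "real \<Rightarrow> ennreal" where [measurable]: "d \<in> borel_measurable lborel"
    and d: "AE x in lborel. indicator D x = d x"
    using completion_ex_borel_measurable by blast
  have [measurable]: "Q \<in> sets borel"
    using Q by simp
  \<comment> \<open>After the exchange of integrals the weight at \<open>t\<close> is the measure of
    the window positions in \<open>D\<close> that see \<open>t\<close>, the quantity bounded below
    by \<open>c\<close>.\<close>
  have inner: "(\<integral>\<^sup>+x. indicator Q (t - x) * d x \<partial>lborel) = emeasure lebesgue {x \<in> D. t \<in> translate Q x}" for t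
  proof -
    have "{x \<in> D. t \<in> translate Q x} \<in> sets lebesgue"
      using sets.Int[OF D, of "{x. t \<in> translate Q x}"] borel_translate_set[OF Q, of t]
      by (auto simp: Int_def)
    then have "emeasure lebesgue {x \<in> D. t \<in> translate Q x} = (\<integral>\<^sup>+x. indicator {x \<in> D. t \<in> translate Q x} x \<partial>lebesgue)"
      by (rule nn_integral_indicator[symmetric])
    also have "\<dots> = (\<integral>\<^sup>+x. indicator {x \<in> D. t \<in> translate Q x} x \<partial>lborel)"
      by (rule nn_integral_completion)
    also have "\<dots> = (\<integral>\<^sup>+x. indicator Q (t - x) * d x \<partial>lborel)"
    proof (rule nn_integral_cong_AE)
      show "AE x in lborel. indicator {x \<in> D. t \<in> translate Q x} x = indicator Q (t - x) * d x"
        using d by eventually_elim (auto simp: indicator_def mem_translate_iff split: if_splits)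
    qed
    finally show ?thesis ..
  qed
  have "c * (\<integral>\<^sup>+t. h t \<partial>lebesgue_on \<Omega>) = c * (\<integral>\<^sup>+t. H t \<partial>lborel)"
    using \<Omega> nn_integral_cong_AE[OF H] by (simp add: nn_integral_restrict_space nn_integral_completion)
  also have "\<dots> = (\<integral>\<^sup>+t. c * H t \<partial>lborel)"
    by (simp add: nn_integral_cmult)
  \<comment> \<open>The lower bound \<open>c\<close> is available almost everywhere on
    \<open>\<Omega>\<close> only; off \<open>\<Omega>\<close> the representative \<open>H\<close> is
    almost everywhere zero, so both sides vanish there.\<close>
  also have "\<dots> \<le> (\<integral>\<^sup>+t. H t * (\<integral>\<^sup>+x. indicator Q (t - x) * d x \<partial>lborel) \<partial>lborel)"
  proof (rule nn_integral_mono_AE)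
    have "AE t in lborel. t \<in> \<Omega> \<longrightarrow> c \<le> emeasure lebesgue {x \<in> D. t \<in> translate Q x}"
      using c \<Omega> by (simp add: AE_restrict_space_iff AE_completion_iff)
    with H show "AE t in lborel. c * H t \<le> H t * (\<integral>\<^sup>+x. indicator Q (t - x) * d x \<partial>lborel)"
    proof eventually_elim
      case (elim t)
      then show ?case
        unfolding inner by (cases "t \<in> \<Omega>") (auto simp: mult.commute[of c] intro: mult_left_mono)
    qed
  qed
  also have "\<dots> = (\<integral>\<^sup>+t. \<integral>\<^sup>+x. H t * (indicator Q (t - x) * d x) \<partial>lborel \<partial>lborel)"
    by (simp add: nn_integral_cmult)
  also have "\<dots> = (\<integral>\<^sup>+x. \<integral>\<^sup>+t. H t * (indicator Q (t - x) * d x) \<partial>lborel \<partial>lborel)"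
    by (rule lborel_pair.Fubini'[symmetric]) measurable
  also have "\<dots> = (\<integral>\<^sup>+x. (\<integral>\<^sup>+t. indicator Q (t - x) * H t \<partial>lborel) * d x \<partial>lborel)"
    by (simp add: mult_ac flip: nn_integral_cmult)
  also have "\<dots> = (\<integral>\<^sup>+x. (\<integral>\<^sup>+t. indicator (translate Q x) t * h t \<partial>lebesgue_on \<Omega>) * indicator D x \<partial>lborel)"
  proof (rule nn_integral_cong_AE)
    have "(\<integral>\<^sup>+t. indicator Q (t - x) * H t \<partial>lborel) = (\<integral>\<^sup>+t. indicator (translate Q x) t * h t \<partial>lebesgue_on \<Omega>)" for x
    proof -
      have "(\<integral>\<^sup>+t. indicator Q (t - x) * H t \<partial>lborel)
        = (\<integral>\<^sup>+t. indicator (translate Q x) t * h t * indicator \<Omega> t \<partial>lborel)"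
      proof (rule nn_integral_cong_AE)
        show "AE t in lborel. indicator Q (t - x) * H t = indicator (translate Q x) t * h t * indicator \<Omega> t"
          using H by eventually_elim (auto simp: indicator_def mem_translate_iff split: if_splits)
      qed
      then show ?thesis
        using \<Omega> by (simp add: nn_integral_restrict_space nn_integral_completion)
    qed
    then show "AE x in lborel. (\<integral>\<^sup>+t. indicator Q (t - x) * H t \<partial>lborel) * d x
       = (\<integral>\<^sup>+t. indicator (translate Q x) t * h t \<partial>lebesgue_on \<Omega>) * indicator D x"
      using d by auto
  qed
  also have "\<dots> = (\<integral>\<^sup>+x. \<integral>\<^sup>+t. indicator (translate Q x) t * h t \<partial>lebesgue_on \<Omega> \<partial>lebesgue_on D)"
    using D by (simp add: nn_integral_restrict_space nn_integral_completion)
  finally show ?thesis .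
qed

lemma borel_measurable_indicator_translate:
  assumes "closed Q"
  shows "(indicator (translate Q x) :: real \<Rightarrow> ennreal) \<in> borel_measurable (lebesgue_on \<Omega>)"
proof -
  have "closed (translate Q x)"
    using closed_translation[OF assms, of x] by (simp add: translate_def add.commute)
  then have "(indicator (translate Q x) :: real \<Rightarrow> ennreal) \<in> borel_measurable lborel"
    by simp
  then show ?thesis
    by (intro measurable_restrict_space1 measurable_completion)
qed

text \<open>The mass \<open>T\<close> of \<open>h\<close> dominates the mass \<open>G\<close> seen through any window, so that
  \<open>G powr a \<ge> T powr (a - 1) * G\<close> for \<open>a \<le> 1\<close>.\<close>
lemma window_lower_bound_finite:
  fixes h :: "real \<Rightarrow> ennreal"
  assumes \<Omega>: "\<Omega> \<in> sets lebesgue" and D: "D \<in> sets lebesgue" and Q: "closed Q"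
    and h [measurable]: "h \<in> borel_measurable (lebesgue_on \<Omega>)"
    and c: "AE z in lebesgue_on \<Omega>. c \<le> emeasure lebesgue {x \<in> D. z \<in> translate Q x}"
    and a: "0 < a" "a \<le> 1"
    and fin: "(\<integral>\<^sup>+t. h t \<partial>lebesgue_on \<Omega>) < \<infinity>"
  shows "c * ennpowr (\<integral>\<^sup>+t. h t \<partial>lebesgue_on \<Omega>) a
     \<le> (\<integral>\<^sup>+x. ennpowr (\<integral>\<^sup>+t. indicator (translate Q x) t * h t \<partial>lebesgue_on \<Omega>) a \<partial>lebesgue_on D)"
proof -
  define G where "G x = (\<integral>\<^sup>+t. indicator (translate Q x) t * h t \<partial>lebesgue_on \<Omega>)" for x
  obtain T where T: "0 \<le> T" "(\<integral>\<^sup>+t. h t \<partial>lebesgue_on \<Omega>) = ennreal T"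
    using fin by (cases "\<integral>\<^sup>+t. h t \<partial>lebesgue_on \<Omega>") auto
  have [measurable]: "(indicator (translate Q x) :: real \<Rightarrow> ennreal) \<in> borel_measurable (lebesgue_on \<Omega>)" for x
    by (rule borel_measurable_indicator_translate[OF Q])
  show ?thesis
  proof (cases "T = 0")
    case False
    \<comment> \<open>The factor \<open>k\<close> does not depend on \<open>x\<close>. It replaces
      the power of \<open>G x\<close> by a linear expression, to which \<open>window_fubini\<close>
      applies with \<open>k * h\<close>.\<close>
    define k where "k = ennreal (T powr (a - 1))"
    have "c * ennpowr (ennreal T) a = c * (k * ennreal T)"
      using T(1) False by (simp add: k_def ennpowr_ennreal powr_diff flip: ennreal_mult)
    also have "\<dots> = c * (\<integral>\<^sup>+t. k * h t \<partial>lebesgue_on \<Omega>)"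
      by (simp add: nn_integral_cmult T(2))
    also have "\<dots> \<le> (\<integral>\<^sup>+x. \<integral>\<^sup>+t. indicator (translate Q x) t * (k * h t) \<partial>lebesgue_on \<Omega> \<partial>lebesgue_on D)"
      by (rule window_fubini[OF \<Omega> D Q _ c]) measurable
    also have "\<dots> = (\<integral>\<^sup>+x. k * G x \<partial>lebesgue_on D)"
      by (simp add: G_def mult.left_commute nn_integral_cmult)
    also have "\<dots> \<le> (\<integral>\<^sup>+x. ennpowr (G x) a \<partial>lebesgue_on D)"
    proof (rule nn_integral_mono)
      fix x
      have "G x \<le> ennreal T"
        unfolding G_def T(2)[symmetric] by (intro nn_integral_mono) (auto simp: indicator_def)
      then obtain g where g: "0 \<le> g" "g \<le> T" "G x = ennreal g"
        using T(1) by (cases "G x") (auto simp: top_unique)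
      have "T powr (a - 1) * g \<le> g powr a"
      \<comment> \<open>A power with exponent \<open>a - 1 \<le> 0\<close> is decreasing on positive
        arguments only; by convention \<open>0 powr (a - 1)\<close> is 0.\<close>
      proof (cases "g = 0")
        case False
        then have "T powr (a - 1) \<le> g powr (a - 1)"
          using g a by (intro powr_mono2') auto
        then have "T powr (a - 1) * g \<le> g powr (a - 1) * g"
          using g by (intro mult_right_mono) auto
        also have "\<dots> = g powr a"
          using g False by (simp add: powr_diff)
        finally show ?thesis .
      qed auto
      then show "k * G x \<le> ennpowr (G x) a"
        using g by (simp add: k_def ennpowr_ennreal flip: ennreal_mult)
    qed
    finally show ?thesis
      by (simp add: G_def T(2))
  qed (simp add: T)
qed

text \<open>If \<open>h\<close> has infinite mass, it is truncated at height \<open>n\<close>, which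
  leaves finite mass because \<open>\<Omega>\<close> has finite measure. A finite right-hand side
  would bound all truncated masses uniformly, and monotone convergence would make the mass of
  \<open>h\<close> finite.\<close>

lemma window_lower_bound:
  fixes h :: "real \<Rightarrow> ennreal"
  assumes \<Omega>: "\<Omega> \<in> sets lebesgue" "emeasure lebesgue \<Omega> < \<infinity>" and D: "D \<in> sets lebesgue" and Q: "closed Q"
    and h [measurable]: "h \<in> borel_measurable (lebesgue_on \<Omega>)"
    and c: "0 < c" "AE z in lebesgue_on \<Omega>. ennreal c \<le> emeasure lebesgue {x \<in> D. z \<in> translate Q x}"
    and a: "0 < a" "a \<le> 1"
  shows "ennreal c * ennpowr (\<integral>\<^sup>+t. h t \<partial>lebesgue_on \<Omega>) a
     \<le> (\<integral>\<^sup>+x. ennpowr (\<integral>\<^sup>+t. indicator (translate Q x) t * h t \<partial>lebesgue_on \<Omega>) a \<partial>lebesgue_on D)"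
    (is "_ \<le> ?R")
proof (cases "(\<integral>\<^sup>+t. h t \<partial>lebesgue_on \<Omega>) < \<infinity>")
  case True
  then show ?thesis
    using window_lower_bound_finite[OF \<Omega>(1) D Q h c(2) a] by blast
next
  case False
  define hn where "hn n t = min (h t) (of_nat n)" for n :: nat and t
  have [measurable]: "hn n \<in> borel_measurable (lebesgue_on \<Omega>)" for n
    unfolding hn_def by measurable
  have R: "?R = \<infinity>"
  proof (rule ccontr)
    assume "?R \<noteq> \<infinity>"
    then obtain R where R: "0 \<le> R" "?R = ennreal R"
      by (cases ?R) auto
    \<comment> \<open>The bound comes from solving \<open>c * T powr a \<le> R\<close> for the
      truncated mass \<open>T\<close>; it does not depend on \<open>n\<close>.\<close>
    have "(\<integral>\<^sup>+t. hn n t \<partial>lebesgue_on \<Omega>) \<le> ennreal ((R / c) powr (1 / a))" for n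
    proof -
      have "(\<integral>\<^sup>+t. hn n t \<partial>lebesgue_on \<Omega>) \<le> (\<integral>\<^sup>+t. of_nat n \<partial>lebesgue_on \<Omega>)"
        by (intro nn_integral_mono) (simp add: hn_def)
      also have "\<dots> < \<infinity>"
        using \<Omega> by (simp add: emeasure_restrict_space ennreal_mult_less_top of_nat_less_top)
      finally have fin: "(\<integral>\<^sup>+t. hn n t \<partial>lebesgue_on \<Omega>) < \<infinity>" .
      then obtain T where T: "0 \<le> T" "(\<integral>\<^sup>+t. hn n t \<partial>lebesgue_on \<Omega>) = ennreal T"
        by (cases "\<integral>\<^sup>+t. hn n t \<partial>lebesgue_on \<Omega>") auto
      have "ennreal c * ennpowr (ennreal T) a
        \<le> (\<integral>\<^sup>+x. ennpowr (\<integral>\<^sup>+t. indicator (translate Q x) t * hn n t \<partial>lebesgue_on \<Omega>) a \<partial>lebesgue_on D)"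
        using window_lower_bound_finite[OF \<Omega>(1) D Q _ c(2) a fin] by (simp add: T)
      also have "\<dots> \<le> ?R"
        using a by (intro nn_integral_mono ennpowr_mono mult_left_mono) (auto simp: hn_def)
      finally have "c * T powr a \<le> R"
        using T(1) R c(1) by (simp add: ennpowr_ennreal flip: ennreal_mult)
      then have "T powr a \<le> R / c"
        using c(1) by (simp add: field_simps)
      then have "(T powr a) powr (1 / a) \<le> (R / c) powr (1 / a)"
        using a by (intro powr_mono2) auto
      then show ?thesis
        using a T by (simp add: powr_powr ennreal_leI)
    qed
    then have "(SUP n. \<integral>\<^sup>+t. hn n t \<partial>lebesgue_on \<Omega>) \<le> ennreal ((R / c) powr (1 / a))"
      by (rule SUP_least)
    moreover have "(SUP n. \<integral>\<^sup>+t. hn n t \<partial>lebesgue_on \<Omega>) = (\<integral>\<^sup>+t. (SUP n. hn n t) \<partial>lebesgue_on \<Omega>)"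
      by (intro nn_integral_monotone_convergence_SUP[symmetric])
         (auto simp: incseq_def le_fun_def hn_def min.coboundedI2)
    moreover have "(SUP n. hn n t) = h t" for t
    proof -
      have "(SUP n. hn n t) = inf (h t) (SUP n. of_nat n)"
        unfolding hn_def inf_min[symmetric] by (rule inf_SUP[symmetric])
      then show ?thesis
        by (simp add: ennreal_SUP_of_nat_eq_top)
    qed
    ultimately have "(\<integral>\<^sup>+t. h t \<partial>lebesgue_on \<Omega>) \<le> ennreal ((R / c) powr (1 / a))"
      by simp
    also have "\<dots> < \<infinity>"
      by simp
    finally show False
      using False by simp
  qed
  then show ?thesis by simp
qed

lemma grand_functional_zero [simp]: "grand_functional D p \<theta> (\<lambda>x. 0) = 0"
proof -
  have "grand_functional D p \<theta> (\<lambda>x. 0) \<le> 0"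
    unfolding grand_functional_def by (rule SUP_least) simp
  then show ?thesis by simp
qed

section \<open>Finiteness of the index set\<close>

text \<open>Finitely many balls of radius \<open>r / 2\<close> cover all points \<open>y j\<close>,
  and two points in the same ball are less than \<open>r\<close> apart. Indices are counted rather
  than points, so \<open>y\<close> may repeat values.\<close>

lemma finite_if_bounded_and_locally_finite:
  fixes y :: "'i \<Rightarrow> real"
  assumes "bounded (y ` I)" "0 < r"
    and loc: "\<And>i. i \<in> I \<Longrightarrow> finite {j \<in> I. \<bar>y j - y i\<bar> < r}"
  shows "finite I"
proof -
  have "compact (closure (y ` I))"
    using assms(1) by simp
  then obtain Z where Z: "finite Z" "closure (y ` I) \<subseteq> (\<Union>z\<in>Z. ball z (r / 2))"
    using assms(2) unfolding compact_eq_totally_bounded by (meson half_gt_zero)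
  have fin: "finite {j \<in> I. y j \<in> ball z (r / 2)}" for z
  \<comment> \<open>Local finiteness is known only around points \<open>y i\<close>, so a covering
    ball is compared with the larger ball around some \<open>y i\<close> that it contains.\<close>
  proof (cases "\<exists>i\<in>I. y i \<in> ball z (r / 2)")
    case True
    then obtain i where "i \<in> I" "y i \<in> ball z (r / 2)" by blast
    then show ?thesis
      by (intro finite_subset[OF _ loc[of i]]) (auto simp: dist_real_def abs_if split: if_splits)
  next
    case False
    then have "{j \<in> I. y j \<in> ball z (r / 2)} = {}"
      by blast
    then show ?thesis
      by (metis finite.emptyI)
  qed
  have "I \<subseteq> (\<Union>z\<in>Z. {j \<in> I. y j \<in> ball z (r / 2)})"
  proof
    fix j assume "j \<in> I"
    then have "y j \<in> closure (y ` I)"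
      by (rule subsetD[OF closure_subset imageI])
    then show "j \<in> (\<Union>z\<in>Z. {j \<in> I. y j \<in> ball z (r / 2)})"
      using Z(2) \<open>j \<in> I\<close> by blast
  qed
  then show ?thesis
    by (rule finite_subset[OF _ finite_UN_I[OF Z(1) fin]])
qed

text \<open>If \<open>U\<close> contains the ball of radius \<open>r\<close> around \<open>u\<close>
  and \<open>y j\<close> is closer than \<open>r\<close> to \<open>y i\<close>, then
  \<open>u + y j\<close> lies in both windows. The overlap condition for \<open>K = U\<close> thus
  allows only finitely many such \<open>j\<close>.\<close>

lemma bupu_finite:
  assumes "bounded \<Omega>" "bupu \<Omega> I \<psi> y U"
  shows "finite I"
proof -
  have U: "compact U" "U \<subseteq> \<Omega>" "interior U \<noteq> {}" and y: "y ` I \<subseteq> \<Omega>"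
    using assms(2) by (auto simp: bupu_def)
  obtain u r where r: "0 < r" "ball u r \<subseteq> U"
    using U(3) by (meson all_not_in_conv mem_interior)
  have lt: "(SUP i\<in>I. emeasure (count_space I) {j \<in> I. translate U (y i) \<inter> translate U (y j) \<noteq> {}}) < \<infinity>"
    using assms(2) U by (simp add: bupu_def)
  show ?thesis
  proof (rule finite_if_bounded_and_locally_finite[OF _ r(1)])
    fix i assume i: "i \<in> I"
    have "emeasure (count_space I) {j \<in> I. translate U (y i) \<inter> translate U (y j) \<noteq> {}} < \<infinity>"
      using le_less_trans[OF SUP_upper[OF i] lt] .
    then have "finite {j \<in> I. translate U (y i) \<inter> translate U (y j) \<noteq> {}}"
      by (subst (asm) emeasure_count_space) (auto split: if_splits)
    moreover have "{j \<in> I. \<bar>y j - y i\<bar> < r} \<subseteq> {j \<in> I. translate U (y i) \<inter> translate U (y j) \<noteq> {}}"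
    proof clarify
      fix j assume "\<bar>y j - y i\<bar> < r" "translate U (y i) \<inter> translate U (y j) = {}"
      moreover have "u + y j \<in> translate U (y j)" "u + y j \<in> translate U (y i)"
        using r \<open>\<bar>y j - y i\<bar> < r\<close> by (auto simp: mem_translate_iff dist_real_def subset_iff)
      ultimately show False by blast
    qed
    ultimately show "finite {j \<in> I. \<bar>y j - y i\<bar> < r}"
      by (rule finite_subset[rotated])
  qed (use y assms(1) bounded_subset in blast)
qed

section \<open>Comparisons with the sum of the piece norms\<close>

context
  fixes \<Omega> Q U :: "real set" and p q \<theta> :: real
    and I :: "'i set" and \<psi> :: "'i \<Rightarrow> real \<Rightarrow> real" and y :: "'i \<Rightarrow> real"
  assumes \<Omega>: "bounded \<Omega>" "\<Omega> \<in> sets lebesgue"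
    and p: "1 < p" and q: "1 < q" and \<theta>: "0 \<le> \<theta>"
    and Q: "compact Q"
    and I: "finite I" and bupu: "bupu \<Omega> I \<psi> y U"
begin

definition piece_sum :: "(real \<Rightarrow> complex) \<Rightarrow> ennreal" where
  "piece_sum f = (\<Sum>i\<in>I. piece_norm \<Omega> \<psi> p \<theta> f i)"

lemma bupu_sum: "x \<in> \<Omega> \<Longrightarrow> (\<Sum>i\<in>I. \<psi> i x) = 1"
  using bupu I by (auto simp: bupu_def has_sum_finite_iff)

lemma bupu_nonneg: "x \<in> \<Omega> \<Longrightarrow> i \<in> I \<Longrightarrow> 0 \<le> \<psi> i x"
  using bupu by (auto simp: bupu_def)

lemma bupu_le_1: "x \<in> \<Omega> \<Longrightarrow> i \<in> I \<Longrightarrow> \<psi> i x \<le> 1"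
  using member_le_sum[of i I "\<lambda>i. \<psi> i x"] bupu_sum[of x] bupu_nonneg[of x] I by auto

text \<open>Since each \<open>\<psi> i\<close> has values between 0 and 1 on
  \<open>\<Omega>\<close>, every piece is pointwise bounded by \<open>f\<close>.\<close>

lemma dominated_piece_sum_grand_norm: "dominated (grand_space_loc \<Omega> p \<theta>) piece_sum (grand_norm \<Omega> p \<theta>)"
\<comment> \<open>The successor keeps the constant positive when \<open>I\<close> is empty.\<close>
proof (rule dominatedI[of "real (Suc (card I))"])
  fix f
  have "piece_norm \<Omega> \<psi> p \<theta> f i \<le> grand_norm \<Omega> p \<theta> f" if "i \<in> I" for i
    unfolding piece_norm_def grand_norm_def
    using bupu_nonneg[OF _ that] bupu_le_1[OF _ that]
    by (intro grand_functional_mono_AE AE_I2)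
       (auto simp: norm_mult mult_left_le space_restrict_space intro!: ennreal_leI)
  then have "piece_sum f \<le> of_nat (card I) * grand_norm \<Omega> p \<theta> f"
    unfolding piece_sum_def by (rule sum_bounded_above)
  also have "\<dots> \<le> of_nat (Suc (card I)) * grand_norm \<Omega> p \<theta> f"
    by (intro mult_right_mono of_nat_mono) auto
  finally show "piece_sum f \<le> ennreal (real (Suc (card I))) * grand_norm \<Omega> p \<theta> f"
    by (simp only: ennreal_of_nat_eq_real_of_nat)
qed auto

text \<open>The pieces add up to \<open>f\<close> on \<open>\<Omega>\<close>, and nonnegativity of
  the \<open>\<psi> i\<close> makes their absolute values add up to that of \<open>f\<close>. The
  triangle inequality with a constant then applies.\<close>

lemma dominated_grand_norm_piece_sum: "dominated (grand_space_loc \<Omega> p \<theta>) (grand_norm \<Omega> p \<theta>) piece_sum"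
proof (rule dominatedI[of "real (Suc (card I * card I))"])
  fix f assume "f \<in> grand_space_loc \<Omega> p \<theta>"
  then have [measurable]: "f \<in> borel_measurable (lebesgue_on \<Omega>)"
    by (simp add: grand_space_loc_def)
  have \<psi>: "\<psi> i \<in> borel_measurable (lebesgue_on \<Omega>)" if "i \<in> I" for i
    using that bupu by (simp add: bupu_def)
  have "grand_norm \<Omega> p \<theta> f
     \<le> grand_functional \<Omega> p \<theta> (\<lambda>x. \<Sum>i\<in>I. ennreal (norm (f x * of_real (\<psi> i x))))"
    unfolding grand_norm_def
  proof (intro grand_functional_mono_AE AE_I2)
    fix x assume "x \<in> space (lebesgue_on \<Omega>)"
    then have x: "x \<in> \<Omega>"
      by (simp add: space_restrict_space)
    have "(\<Sum>i\<in>I. norm (f x * of_real (\<psi> i x))) = norm (f x) * (\<Sum>i\<in>I. \<psi> i x)"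
      using bupu_nonneg[OF x] by (simp add: norm_mult sum_distrib_left)
    then show "ennreal (norm (f x)) \<le> (\<Sum>i\<in>I. ennreal (norm (f x * of_real (\<psi> i x))))"
      using bupu_sum[OF x] by simp
  qed
  also have "\<dots> \<le> of_nat (card I * card I) * piece_sum f"
    unfolding piece_sum_def piece_norm_def grand_norm_def
  proof (rule grand_functional_sum_le[OF I])
    fix i assume "i \<in> I"
    note [measurable] = \<psi>[OF this]
    show "(\<lambda>x. ennreal (norm (f x * of_real (\<psi> i x)))) \<in> borel_measurable (lebesgue_on \<Omega>)"
      by measurable
  qed
  also have "\<dots> \<le> of_nat (Suc (card I * card I)) * piece_sum f"
    by (intro mult_right_mono of_nat_mono) auto
  finally show "grand_norm \<Omega> p \<theta> f \<le> ennreal (real (Suc (card I * card I))) * piece_sum f"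
    by (simp only: ennreal_of_nat_eq_real_of_nat)
qed (rule of_nat_0_less_iff[THEN iffD2], simp)

text \<open>At the parameter \<open>\<eta> = q - 1\<close> the exponent is 1, and the term of the
  supremum is the plain sum times \<open>(q - 1) powr \<theta>\<close>.\<close>

lemma dominated_piece_sum_seq_norm:
  "dominated (grand_space_loc \<Omega> p \<theta>) piece_sum (\<lambda>f. grand_seq_norm I q \<theta> (piece_norm \<Omega> \<psi> p \<theta> f))"
proof (rule dominatedI[of "1 / (q - 1) powr \<theta>"])
  fix f
  have "ennreal ((q - 1) powr \<theta>) * piece_sum f \<le> grand_seq_norm I q \<theta> (piece_norm \<Omega> \<psi> p \<theta> f)"
    unfolding grand_seq_norm_def piece_sum_def
    by (rule SUP_upper2[of "q - 1"]) (use q I in auto)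
  then have "ennreal (1 / (q - 1) powr \<theta>) * (ennreal ((q - 1) powr \<theta>) * piece_sum f)
     \<le> ennreal (1 / (q - 1) powr \<theta>) * grand_seq_norm I q \<theta> (piece_norm \<Omega> \<psi> p \<theta> f)"
    by (rule mult_left_mono) auto
  then show "piece_sum f \<le> ennreal (1 / (q - 1) powr \<theta>) * grand_seq_norm I q \<theta> (piece_norm \<Omega> \<psi> p \<theta> f)"
    using q by (simp flip: mult.assoc ennreal_mult)
qed (use q in auto)

text \<open>Each entry is at most the sum \<open>s\<close>, so the sum of the \<open>r\<close>-th
  powers is at most \<open>card I\<close> times that of \<open>s\<close>. The root leaves
  \<open>s\<close>, a factor at most \<open>card I\<close>, and the weight with exponent
  \<open>\<theta> / r\<close>.\<close>

lemma dominated_seq_norm_piece_sum: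
  "dominated (grand_space_loc \<Omega> p \<theta>) (\<lambda>f. grand_seq_norm I q \<theta> (piece_norm \<Omega> \<psi> p \<theta> f)) piece_sum"
proof (rule dominatedI[of "max 1 (q - 1) powr \<theta> * real (Suc (card I))"])
  fix f
  define s where "s = piece_sum f"
  show "grand_seq_norm I q \<theta> (piece_norm \<Omega> \<psi> p \<theta> f)
     \<le> ennreal (max 1 (q - 1) powr \<theta> * real (Suc (card I))) * piece_sum f"
    unfolding grand_seq_norm_def s_def[symmetric]
  proof (rule SUP_least)
    fix \<eta> assume \<eta>: "\<eta> \<in> {0<..q - 1}"
    define r where "r = q - \<eta>"
    have r: "1 \<le> r" using \<eta> by (auto simp: r_def)
    have "piece_norm \<Omega> \<psi> p \<theta> f k \<le> s" if "k \<in> I" for k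
      unfolding s_def piece_sum_def by (rule member_le_sum) (use I that in auto)
    then have "(\<Sum>k\<in>I. ennpowr (piece_norm \<Omega> \<psi> p \<theta> f k) r) \<le> of_nat (card I) * ennpowr s r"
      by (intro sum_bounded_above ennpowr_mono) (use r in auto)
    then have "ennpowr (ennreal (\<eta> powr \<theta>) * (\<Sum>k\<in>I. ennpowr (piece_norm \<Omega> \<psi> p \<theta> f k) r)) (1 / r)
      \<le> ennpowr (ennreal (\<eta> powr \<theta>) * (of_nat (card I) * ennpowr s r)) (1 / r)"
      by (intro ennpowr_mono mult_left_mono) (use r in auto)
    also have "\<dots> = ennreal (\<eta> powr (\<theta> / r)) * (ennpowr (of_nat (card I)) (1 / r) * s)"
      using r by (simp add: ennpowr_mult ennpowr_ennpowr ennpowr_ennreal powr_powr)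
    also have "\<dots> \<le> ennreal (max 1 (q - 1) powr \<theta>) * (of_nat (Suc (card I)) * s)"
    proof (intro mult_mono ennreal_leI)
      show "\<eta> powr (\<theta> / r) \<le> max 1 (q - 1) powr \<theta>"
        using weight_powr_le[OF \<eta> \<theta>] by (simp add: r_def)
      have "ennpowr (of_nat (card I)) (1 / r) \<le> of_nat (card I)"
        by (rule ennpowr_of_nat_le) (use r in auto)
      also have "\<dots> \<le> (of_nat (Suc (card I)) :: ennreal)"
        by (intro of_nat_mono) auto
      finally show "ennpowr (of_nat (card I)) (1 / r) \<le> of_nat (Suc (card I))" .
    qed auto
    also have "\<dots> = ennreal (max 1 (q - 1) powr \<theta> * real (Suc (card I))) * s"
      by (simp only: ennreal_mult' of_nat_0_le_iff powr_ge_zero ennreal_of_nat_eq_real_of_nat mult.assoc)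
    finally show "ennpowr (ennreal (\<eta> powr \<theta>) * (\<Sum>\<^sub>\<infinity>k\<in>I. ennpowr (piece_norm \<Omega> \<psi> p \<theta> f k) (q - \<eta>))) (1 / (q - \<eta>))
      \<le> ennreal (max 1 (q - 1) powr \<theta> * real (Suc (card I))) * s"
      using I by (simp add: r_def)
  qed
qed auto

text \<open>Control functions and step functions vanish outside one bounded interval, independent of
  \<open>f\<close>. Over the whole line their outer norms therefore see only a set of finite
  measure.\<close>

lemma support_bound:
  obtains R M where "1 \<le> M" "emeasure lebesgue (cball 0 R :: real set) \<le> ennreal M"
    and "\<And>i. i \<in> I \<Longrightarrow> translate U (y i) \<subseteq> cball 0 R"
    and "\<And>x t. t \<in> \<Omega> \<Longrightarrow> t \<in> translate Q x \<Longrightarrow> x \<in> cball 0 R"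
proof -
  have "U \<subseteq> \<Omega>" "\<And>i. i \<in> I \<Longrightarrow> y i \<in> \<Omega>"
    using bupu by (auto simp: bupu_def)
  obtain a b where a: "\<And>t. t \<in> \<Omega> \<Longrightarrow> \<bar>t\<bar> \<le> a" and b: "\<And>t. t \<in> Q \<Longrightarrow> \<bar>t\<bar> \<le> b"
    using \<Omega>(1) compact_imp_bounded[OF Q] by (auto simp: bounded_iff)
  \<comment> \<open>Points of \<open>U + y i\<close> have modulus at most \<open>2 * a\<close>, and
    a window \<open>Q + x\<close> that meets \<open>\<Omega>\<close> forces the modulus of
    \<open>x\<close> to be at most \<open>a + b\<close>. Absolute values keep \<open>R\<close>
    nonnegative even if \<open>a\<close> or \<open>b\<close> bounds an empty set.\<close>
  define R where "R = 2 * \<bar>a\<bar> + \<bar>b\<bar>"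
  show thesis
  proof (rule that[of "max 1 (2 * R)" R])
    show "emeasure lebesgue (cball 0 R :: real set) \<le> ennreal (max 1 (2 * R))"
      using emeasure_lborel_Icc[of "- R" R] by (simp add: cball_eq_atLeastAtMost R_def ennreal_leI del: ennreal_plus)
    show "translate U (y i) \<subseteq> cball 0 R" if "i \<in> I" for i
    proof
      fix t assume "t \<in> translate U (y i)"
      then have "\<bar>t - y i\<bar> \<le> a" "\<bar>y i\<bar> \<le> a"
        using a \<open>U \<subseteq> \<Omega>\<close> \<open>\<And>i. i \<in> I \<Longrightarrow> y i \<in> \<Omega>\<close> that by (auto simp: mem_translate_iff)
      then show "t \<in> cball 0 R" by (simp add: R_def)
    qed
    show "x \<in> cball 0 R" if "t \<in> \<Omega>" "t \<in> translate Q x" for x t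
      using a[OF that(1)] b[of "t - x"] that(2) by (simp add: R_def mem_translate_iff)
  qed simp
qed

section \<open>Comparisons of norms over an outer domain\<close>

context
  fixes D :: "real set"
  assumes D: "D \<in> sets lebesgue"
begin

lemma dominated_step_norm_piece_sum: "dominated (grand_space_loc \<Omega> p \<theta>) (step_norm \<Omega> D I \<psi> y U p q \<theta>) piece_sum"
proof -
  obtain R M where M: "1 \<le> M" "emeasure lebesgue (cball 0 R :: real set) \<le> ennreal M"
    and R: "\<And>i. i \<in> I \<Longrightarrow> translate U (y i) \<subseteq> cball 0 R"
    using support_bound by metis
  show ?thesis
  proof (rule dominatedI[of "max 1 (q - 1) powr \<theta> * M"])
    fix f
    show "step_norm \<Omega> D I \<psi> y U p q \<theta> f \<le> ennreal (max 1 (q - 1) powr \<theta> * M) * piece_sum f"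
      unfolding step_norm_def
    proof (rule grand_functional_le_const[OF q \<theta> D _ M(2,1)])
      fix x
      have "(\<Sum>i\<in>I. piece_norm \<Omega> \<psi> p \<theta> f i * indicator (translate U (y i)) x)
        \<le> (\<Sum>i\<in>I. piece_norm \<Omega> \<psi> p \<theta> f i * indicator (cball 0 R) x)"
        using R by (intro sum_mono mult_left_mono) (simp_all add: indicator_def subset_iff)
      then show "(\<Sum>\<^sub>\<infinity>i\<in>I. piece_norm \<Omega> \<psi> p \<theta> f i * indicator (translate U (y i)) x)
        \<le> piece_sum f * indicator (cball 0 R) x"
        using I by (simp add: piece_sum_def sum_distrib_right)
    qed auto
  qed (use M(1) in auto)
qed

text \<open>The control function never exceeds the norm of \<open>f\<close>, and it is zero where
  the window misses \<open>\<Omega>\<close>, in particular off \<open>cball 0 R\<close>.\<close>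

lemma dominated_amalgam_norm_grand_norm:
  "dominated (grand_space_loc \<Omega> p \<theta>) (amalgam_norm \<Omega> D Q p q \<theta>) (grand_norm \<Omega> p \<theta>)"
proof -
  obtain R M where M: "1 \<le> M" "emeasure lebesgue (cball 0 R :: real set) \<le> ennreal M"
    and R: "\<And>x t. t \<in> \<Omega> \<Longrightarrow> t \<in> translate Q x \<Longrightarrow> x \<in> cball 0 R"
    using support_bound by metis
  show ?thesis
  proof (rule dominatedI[of "max 1 (q - 1) powr \<theta> * M"])
    fix f
    show "amalgam_norm \<Omega> D Q p q \<theta> f \<le> ennreal (max 1 (q - 1) powr \<theta> * M) * grand_norm \<Omega> p \<theta> f"
      unfolding amalgam_norm_def
    proof (rule grand_functional_le_const[OF q \<theta> D _ M(2,1)])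
      fix x
      show "control \<Omega> Q p \<theta> f x \<le> grand_norm \<Omega> p \<theta> f * indicator (cball 0 R) x"
      proof (cases "x \<in> cball 0 R")
        case True
        have "control \<Omega> Q p \<theta> f x \<le> grand_norm \<Omega> p \<theta> f"
          unfolding control_def grand_norm_def
          by (intro grand_functional_mono_AE AE_I2 ennreal_leI) (auto simp: indicator_def)
        then show ?thesis using True by simp
      next
        case False
        then have "control \<Omega> Q p \<theta> f x \<le> grand_functional \<Omega> p \<theta> (\<lambda>t. 0)"
          unfolding control_def grand_norm_def using R
          by (intro grand_functional_mono_AE AE_I2) (auto simp: indicator_def space_restrict_space)
        then show ?thesis by simp
      qed
    qed auto
  qed (use M(1) in auto)
qed

text \<open>For a fixed \<open>\<epsilon>\<close>, the weighted root of the windowed integral is one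
  term of the supremum defining \<open>control\<close>. The window bound has the same constant
  \<open>c\<close> for every \<open>\<epsilon>\<close>, so the supremum over
  \<open>\<epsilon>\<close> can be taken after integrating in \<open>x\<close>.\<close>

lemma dominated_grand_norm_amalgam_norm:
  assumes c: "0 < c" "AE z in lebesgue_on \<Omega>. ennreal c \<le> emeasure lebesgue {x \<in> D. z \<in> translate Q x}"
  shows "dominated (grand_space_loc \<Omega> p \<theta>) (grand_norm \<Omega> p \<theta>) (amalgam_norm \<Omega> D Q p q \<theta>)"
proof (rule dominatedI[of "1 / ((q - 1) powr \<theta> * c)"])
  fix f assume "f \<in> grand_space_loc \<Omega> p \<theta>"
  then have [measurable]: "f \<in> borel_measurable (lebesgue_on \<Omega>)"
    by (simp add: grand_space_loc_def)
  have fin: "emeasure lebesgue \<Omega> < \<infinity>"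
    using fmeasurableD2[OF bounded_set_imp_lmeasurable[OF \<Omega>]] by (simp add: less_top)
  have "ennreal c * grand_norm \<Omega> p \<theta> f \<le> (\<integral>\<^sup>+x. control \<Omega> Q p \<theta> f x \<partial>lebesgue_on D)"
    unfolding grand_norm_def grand_functional_def SUP_mult_left_ennreal
  proof (rule SUP_least)
    fix \<epsilon> assume \<epsilon>: "\<epsilon> \<in> {0<..p - 1}"
    define r where "r = p - \<epsilon>"
    have r: "1 \<le> r" using \<epsilon> by (auto simp: r_def)
    define w where "w = ennreal (\<epsilon> powr (\<theta> / r))"
    define h where "h t = ennpowr (ennreal (norm (f t))) r" for t
    have [measurable]: "h \<in> borel_measurable (lebesgue_on \<Omega>)"
      unfolding h_def by measurable
    have [measurable]: "(indicator (translate Q x) :: real \<Rightarrow> ennreal) \<in> borel_measurable (lebesgue_on \<Omega>)" for x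
      by (rule borel_measurable_indicator_translate[OF compact_imp_closed[OF Q]])
    \<comment> \<open>The weight moves under the root as \<open>ennpowr w r\<close>, so that the
      window bound applies to the weighted integrand.\<close>
    have "ennreal c * (w * ennpowr (\<integral>\<^sup>+t. h t \<partial>lebesgue_on \<Omega>) (1 / r))
      = ennreal c * ennpowr (\<integral>\<^sup>+t. ennpowr w r * h t \<partial>lebesgue_on \<Omega>) (1 / r)"
      using r by (simp add: nn_integral_cmult ennpowr_mult ennpowr_ennpowr)
    also have "\<dots> \<le> (\<integral>\<^sup>+x. ennpowr (\<integral>\<^sup>+t. indicator (translate Q x) t * (ennpowr w r * h t) \<partial>lebesgue_on \<Omega>) (1 / r) \<partial>lebesgue_on D)"
      by (rule window_lower_bound[OF \<Omega>(2) fin D compact_imp_closed[OF Q] _ c]) (use r in auto)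
    also have "\<dots> \<le> (\<integral>\<^sup>+x. control \<Omega> Q p \<theta> f x \<partial>lebesgue_on D)"
    proof (rule nn_integral_mono)
      fix x
      have "ennpowr (\<integral>\<^sup>+t. indicator (translate Q x) t * (ennpowr w r * h t) \<partial>lebesgue_on \<Omega>) (1 / r)
        = w * ennpowr (\<integral>\<^sup>+t. indicator (translate Q x) t * h t \<partial>lebesgue_on \<Omega>) (1 / r)"
        using r by (simp add: mult.left_commute nn_integral_cmult ennpowr_mult ennpowr_ennpowr)
      also have "\<dots> = w * ennpowr (\<integral>\<^sup>+t. ennpowr (ennreal (norm (indicator (translate Q x) t * f t))) r \<partial>lebesgue_on \<Omega>) (1 / r)"
        unfolding h_def by (intro arg_cong[where f = "\<lambda>u. w * ennpowr u (1 / r)"] nn_integral_cong) (auto simp: indicator_def)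
      also have "\<dots> \<le> control \<Omega> Q p \<theta> f x"
        unfolding control_def grand_norm_def grand_functional_def w_def r_def
        using \<epsilon> by (rule SUP_upper)
      finally show "ennpowr (\<integral>\<^sup>+t. indicator (translate Q x) t * (ennpowr w r * h t) \<partial>lebesgue_on \<Omega>) (1 / r)
        \<le> control \<Omega> Q p \<theta> f x" .
    qed
    finally show "ennreal c * (ennreal (\<epsilon> powr (\<theta> / (p - \<epsilon>))) *
        ennpowr (\<integral>\<^sup>+ x. ennpowr (ennreal (norm (f x))) (p - \<epsilon>) \<partial>lebesgue_on \<Omega>) (1 / (p - \<epsilon>)))
      \<le> (\<integral>\<^sup>+x. control \<Omega> Q p \<theta> f x \<partial>lebesgue_on D)"
      by (simp add: w_def h_def r_def)
  qed
  then have "ennreal ((q - 1) powr \<theta>) * (ennreal c * grand_norm \<Omega> p \<theta> f)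
     \<le> ennreal ((q - 1) powr \<theta>) * (\<integral>\<^sup>+x. control \<Omega> Q p \<theta> f x \<partial>lebesgue_on D)"
    by (rule mult_left_mono) auto
  also have "\<dots> \<le> amalgam_norm \<Omega> D Q p q \<theta> f"
    unfolding amalgam_norm_def by (rule grand_functional_ge_integral[OF q])
  finally have "ennreal (1 / ((q - 1) powr \<theta> * c)) * (ennreal ((q - 1) powr \<theta>) * (ennreal c * grand_norm \<Omega> p \<theta> f))
     \<le> ennreal (1 / ((q - 1) powr \<theta> * c)) * amalgam_norm \<Omega> D Q p q \<theta> f"
    by (rule mult_left_mono) auto
  then show "grand_norm \<Omega> p \<theta> f \<le> ennreal (1 / ((q - 1) powr \<theta> * c)) * amalgam_norm \<Omega> D Q p q \<theta> f"
    using q c(1) by (simp flip: mult.assoc ennreal_mult)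
qed (use c(1) q in auto)

text \<open>A piece whose window \<open>U + y i\<close> meets \<open>D\<close> in a null set vanishes almost everywhere, so the
  missing lower bound for that window does no harm.\<close>
lemma dominated_piece_sum_step_norm:
  assumes "\<Omega> \<subseteq> D"
  shows "dominated (grand_space_loc \<Omega> p \<theta>) piece_sum (step_norm \<Omega> D I \<psi> y U p q \<theta>)"
proof -
  define V where "V i = translate U (y i) \<inter> D" for i
  \<comment> \<open>For a window of positive measure in \<open>D\<close>, the constant undoes the
    factor \<open>(q - 1) powr \<theta>\<close> of the parameter \<open>q - 1\<close> and the
    measure of the window. For a null window the piece norm is 0, and so the constant 0
    suffices.\<close>
  define C where "C i = (if measure lebesgue (V i) = 0 then 0 else 1 / ((q - 1) powr \<theta> * measure lebesgue (V i)))" for i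
  have C0: "0 \<le> C i" for i
    by (simp add: C_def)
  have V: "V i \<in> lmeasurable" for i
  proof -
    have "compact (translate U (y i))"
      using compact_translation[of U "y i"] bupu by (simp add: bupu_def translate_def add.commute)
    then show ?thesis
      unfolding V_def using D by (intro fmeasurable_Int_fmeasurable lmeasurable_compact)
  qed
  have le: "piece_norm \<Omega> \<psi> p \<theta> f i \<le> ennreal (C i) * step_norm \<Omega> D I \<psi> y U p q \<theta> f" if i: "i \<in> I" for f i
  proof (cases "measure lebesgue (V i) = 0")
    case True
    then have "emeasure lebesgue (V i) = 0"
      unfolding emeasure_eq_measure2[OF V] by simp
    then have "V i \<in> null_sets lebesgue"
      using fmeasurableD[OF V] by (rule null_setsI)
    then have "AE x in lebesgue. x \<notin> V i"
      by (rule AE_not_in)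
    then have notin: "AE x in lebesgue_on \<Omega>. x \<notin> V i"
      using \<Omega>(2) by (simp add: AE_restrict_space_iff) (auto elim: eventually_mono)
    \<comment> \<open>As \<open>\<Omega> \<subseteq> D\<close>, a point of \<open>\<Omega>\<close>
      outside \<open>V i\<close> lies outside \<open>U + y i\<close>, hence outside the support of
      \<open>\<psi> i\<close>.\<close>
    have zero: "\<psi> i x = 0" if "x \<in> \<Omega>" "x \<notin> V i" for x
    proof -
      have "closure {x \<in> \<Omega>. \<psi> i x \<noteq> 0} \<subseteq> translate U (y i)"
        using bupu i unfolding bupu_def by blast
      then have "{x \<in> \<Omega>. \<psi> i x \<noteq> 0} \<subseteq> translate U (y i)"
        by (rule order_trans[OF closure_subset])
      then show ?thesis
        using that assms unfolding V_def by blast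
    qed
    have "AE x in lebesgue_on \<Omega>. ennreal (norm (f x * of_real (\<psi> i x))) \<le> 0"
      using notin AE_space by eventually_elim (simp add: space_restrict_space zero)
    then have "piece_norm \<Omega> \<psi> p \<theta> f i \<le> grand_functional \<Omega> p \<theta> (\<lambda>t. 0)"
      unfolding piece_norm_def grand_norm_def by (rule grand_functional_mono_AE)
    then show ?thesis
      by simp
  next
    case False
    define a where "a = piece_norm \<Omega> \<psi> p \<theta> f i"
    define \<mu> where "\<mu> = measure lebesgue (V i)"
    have \<mu>: "0 < \<mu>"
      using False unfolding \<mu>_def zero_less_measure_iff .
    have "ennreal \<mu> * a = a * emeasure lebesgue (V i)"
      unfolding \<mu>_def emeasure_eq_measure2[OF V] by (rule mult.commute)
    also have "\<dots> = (\<integral>\<^sup>+x. a * indicator (V i) x \<partial>lebesgue)"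
      by (rule nn_integral_cmult_indicator[OF fmeasurableD[OF V], symmetric])
    also have "\<dots> = (\<integral>\<^sup>+x. a * indicator (translate U (y i)) x \<partial>lebesgue_on D)"
      using D by (auto simp: nn_integral_restrict_space V_def indicator_def intro!: nn_integral_cong)
    \<comment> \<open>A single term of the step function is kept; overlaps of the windows can only
      increase the sum.\<close>
    also have "\<dots> \<le> (\<integral>\<^sup>+x. (\<Sum>\<^sub>\<infinity>j\<in>I. piece_norm \<Omega> \<psi> p \<theta> f j * indicator (translate U (y j)) x) \<partial>lebesgue_on D)"
    proof (rule nn_integral_mono)
      fix x
      show "a * indicator (translate U (y i)) x \<le> (\<Sum>\<^sub>\<infinity>j\<in>I. piece_norm \<Omega> \<psi> p \<theta> f j * indicator (translate U (y j)) x)"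
        using I i member_le_sum[of i I "\<lambda>j. piece_norm \<Omega> \<psi> p \<theta> f j * indicator (translate U (y j)) x"]
        by (simp add: a_def)
    qed
    finally have "ennreal ((q - 1) powr \<theta>) * (ennreal \<mu> * a) \<le> step_norm \<Omega> D I \<psi> y U p q \<theta> f"
      unfolding step_norm_def
      by (intro order_trans[OF _ grand_functional_ge_integral[OF q]] mult_left_mono) auto
    then have "ennreal (C i) * (ennreal ((q - 1) powr \<theta>) * (ennreal \<mu> * a)) \<le> ennreal (C i) * step_norm \<Omega> D I \<psi> y U p q \<theta> f"
      by (rule mult_left_mono) auto
    then show ?thesis
      using q \<mu> by (simp add: a_def C_def flip: \<mu>_def mult.assoc ennreal_mult)
  qed
  show ?thesis
  \<comment> \<open>The summand 1 keeps the constant positive even if all \<open>C i\<close> are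
    0.\<close>
  proof (rule dominatedI[of "1 + (\<Sum>i\<in>I. C i)"])
    fix f
    have "piece_sum f \<le> (\<Sum>i\<in>I. ennreal (C i) * step_norm \<Omega> D I \<psi> y U p q \<theta> f)"
      unfolding piece_sum_def by (intro sum_mono le)
    also have "\<dots> = ennreal (\<Sum>i\<in>I. C i) * step_norm \<Omega> D I \<psi> y U p q \<theta> f"
      using C0 by (simp flip: sum_distrib_right)
    also have "\<dots> \<le> ennreal (1 + (\<Sum>i\<in>I. C i)) * step_norm \<Omega> D I \<psi> y U p q \<theta> f"
      by (intro mult_right_mono ennreal_leI) auto
    finally show "piece_sum f \<le> ennreal (1 + (\<Sum>i\<in>I. C i)) * step_norm \<Omega> D I \<psi> y U p q \<theta> f" .
  qed (use C0 in \<open>simp add: add_pos_nonneg sum_nonneg\<close>)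
qed

lemma norm_equiv_step_seq:
  assumes "\<Omega> \<subseteq> D"
  shows "norm_equiv (grand_space_loc \<Omega> p \<theta>) (step_norm \<Omega> D I \<psi> y U p q \<theta>) (\<lambda>f. grand_seq_norm I q \<theta> (piece_norm \<Omega> \<psi> p \<theta> f))"
  using dominated_trans[OF dominated_step_norm_piece_sum dominated_piece_sum_seq_norm]
    dominated_trans[OF dominated_seq_norm_piece_sum dominated_piece_sum_step_norm[OF assms]]
  by (rule norm_equiv_if_dominated)

lemma norm_equiv_amalgam_step:
  assumes "\<Omega> \<subseteq> D"
    and "0 < c" "AE z in lebesgue_on \<Omega>. ennreal c \<le> emeasure lebesgue {x \<in> D. z \<in> translate Q x}"
  shows "norm_equiv (grand_space_loc \<Omega> p \<theta>) (amalgam_norm \<Omega> D Q p q \<theta>) (step_norm \<Omega> D I \<psi> y U p q \<theta>)"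
proof (rule norm_equiv_if_dominated)
  note dominated_amalgam_norm_grand_norm
  also note dominated_grand_norm_piece_sum
  also note dominated_piece_sum_step_norm[OF assms(1)]
  finally show "dominated (grand_space_loc \<Omega> p \<theta>) (amalgam_norm \<Omega> D Q p q \<theta>) (step_norm \<Omega> D I \<psi> y U p q \<theta>)" .
  note dominated_step_norm_piece_sum
  also note dominated_piece_sum_grand_norm
  also note dominated_grand_norm_amalgam_norm[OF assms(2,3)]
  finally show "dominated (grand_space_loc \<Omega> p \<theta>) (step_norm \<Omega> D I \<psi> y U p q \<theta>) (amalgam_norm \<Omega> D Q p q \<theta>)" .
qed

end

end

section \<open>The window condition on the line and the equivalences\<close>

text \<open>The positions whose window contains \<open>z\<close> include the ball of radius
  \<open>r\<close> around \<open>z - u\<close>, where \<open>ball u r \<subseteq> Q\<close>. Its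
  measure \<open>2 * r\<close> does not depend on \<open>z\<close>, and \<open>c = r\<close> is a
  convenient smaller value.\<close>

lemma window_nondegenerate_UNIV:
  assumes "closed Q" "interior Q \<noteq> {}"
  obtains c where "0 < c" "\<And>z. ennreal c \<le> emeasure lebesgue {x \<in> UNIV. z \<in> translate Q x}"
proof -
  obtain u r where r: "0 < r" "ball u r \<subseteq> Q"
    using assms(2) by (meson all_not_in_conv mem_interior)
  show thesis
  proof (rule that[OF r(1)])
    fix z
    show "ennreal r \<le> emeasure lebesgue {x \<in> UNIV. z \<in> translate Q x}"
    proof -
      have "ennreal r \<le> emeasure lebesgue (ball (z - u) r)"
        using r(1) by (simp add: ball_eq_greaterThanLessThan ennreal_leI)
      also have "\<dots> \<le> emeasure lebesgue {x \<in> UNIV. z \<in> translate Q x}"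
      proof (rule emeasure_mono)
        have "z - x \<in> ball u r" if "x \<in> ball (z - u) r" for x
          using that by (simp add: dist_real_def algebra_simps)
        then show "ball (z - u) r \<subseteq> {x \<in> UNIV. z \<in> translate Q x}"
          using r(2) by (auto simp only: mem_translate_iff)
        show "{x \<in> UNIV. z \<in> translate Q x} \<in> sets lebesgue"
          using borel_translate_set[OF assms(1), of z] by simp
      qed
      finally show ?thesis .
    qed
  qed
qed

text \<open>Both outer domains are treated, \<open>\<Omega>\<close> and the whole line. The relation
  between the step norm and the sequence norm is an equivalence of norms, since the measures of the
  windows \<open>U + y i\<close> enter the former but not the latter.\<close>

theorem theorem3:
  fixes \<Omega> Q U :: "real set" and p q \<theta> :: real
    and I :: "'i set" and \<psi> :: "'i \<Rightarrow> real \<Rightarrow> real" and y :: "'i \<Rightarrow> real"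
  assumes "bounded \<Omega>" and "\<Omega> \<in> sets lebesgue"
    and "1 < p" and "1 < q" and "0 \<le> \<theta>"
    and "compact Q" and "Q \<subseteq> \<Omega>" and "interior Q \<noteq> {}"
    and "bupu \<Omega> I \<psi> y U"
  shows
    "(window_nondegenerate \<Omega> Q \<longrightarrow>
        norm_equiv (grand_space_loc \<Omega> p \<theta>)
          (amalgam_norm \<Omega> \<Omega> Q p q \<theta>) (step_norm \<Omega> \<Omega> I \<psi> y U p q \<theta>)) \<and>
     norm_equiv (grand_space_loc \<Omega> p \<theta>)
       (step_norm \<Omega> \<Omega> I \<psi> y U p q \<theta>) (\<lambda>f. grand_seq_norm I q \<theta> (piece_norm \<Omega> \<psi> p \<theta> f)) \<and>
     norm_equiv (grand_space_loc \<Omega> p \<theta>)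
       (amalgam_norm \<Omega> UNIV Q p q \<theta>) (step_norm \<Omega> UNIV I \<psi> y U p q \<theta>) \<and>
     norm_equiv (grand_space_loc \<Omega> p \<theta>)
       (step_norm \<Omega> UNIV I \<psi> y U p q \<theta>) (\<lambda>f. grand_seq_norm I q \<theta> (piece_norm \<Omega> \<psi> p \<theta> f))"
proof -
  have "finite I"
    using bupu_finite assms(1,9) by blast
  note equiv_assms = assms(1-6) this assms(9)
  obtain c where "0 < c" "\<And>z. ennreal c \<le> emeasure lebesgue {x \<in> UNIV. z \<in> translate Q x}"
    using window_nondegenerate_UNIV[OF compact_imp_closed[OF assms(6)] assms(8)] by blast
  then have "norm_equiv (grand_space_loc \<Omega> p \<theta>)
       (amalgam_norm \<Omega> UNIV Q p q \<theta>) (step_norm \<Omega> UNIV I \<psi> y U p q \<theta>)"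
    by (intro norm_equiv_amalgam_step[OF equiv_assms]) auto
  moreover have "norm_equiv (grand_space_loc \<Omega> p \<theta>)
          (amalgam_norm \<Omega> \<Omega> Q p q \<theta>) (step_norm \<Omega> \<Omega> I \<psi> y U p q \<theta>)"
    if "window_nondegenerate \<Omega> Q"
    using that norm_equiv_amalgam_step[OF equiv_assms assms(2) order_refl]
    unfolding window_nondegenerate_def by blast
  ultimately show ?thesis
    using norm_equiv_step_seq[OF equiv_assms assms(2) order_refl]
      norm_equiv_step_seq[OF equiv_assms, of UNIV] by simp
qed

end
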